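(* Let $\Omega\subseteq\mathbb{R}^d$ be open and bounded and let $f\in L^2(\Omega)\cap\mathrm{BV}(\Omega)$. For $\alpha,\beta>0$ let $$(u_{\beta,\alpha},w_{\beta,\alpha})\in\operatorname*{argmin}_{u\in\mathrm{BV}(\Omega),\ w\in\mathrm{BD}(\Omega)}\ \frac12\|f-u\|_{L^2(\Omega)}^2+\alpha\|Du-w\|_{\mathcal M}+\beta\|\mathcal{E}w\|_{\mathcal M}.$$ Then: (i) for fixed $\alpha>0$, $\|f-u_{\beta,\alpha}\|_{L^2(\Omega)}^2\to0$ as $\beta\to0$; (ii) for fixed $\beta>0$, $\|f-u_{\beta,\alpha}\|_{L^2(\Omega)}^2\to0$ as $\alpha\to0$.
   Context: For an $\mathbb{R}^\ell$-valued distribution $\mathcal T$ on $\Omega$, the Radon norm is $\|\mathcal T\|_{\mathcal M}=\sup\{\langle \mathcal T,v\rangle: v\in C_c^\infty(\Omega;\mathbb{R}^\ell),\ \|v\|_\infty\le 1\}$ (Euclidean norm pointwise; matrices are identified with vectors). $\mathrm{BV}(\Omega)$ is the space of $u\in L^1(\Omega)$ whose distributional derivative $Du$ is a finite Radon measure. $\mathrm{BD}(\Omega)$ is the space of $w\in L^1(\Omega;\mathbb{R}^d)$ whose symmetrised distributional gradient $\mathcal{E}w=\frac12(Dw+Dw^{T})$ is an $\mathbb{R}^{d\times d}$-valued finite Radon measure. In $\|Du-w\|_{\mathcal M}$, $w$ is identified with the measure $w\mathcal{L}^d$. *)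

theory Defs
  imports "HOL-Analysis.Analysis"
begin

primrec Ck :: "nat \<Rightarrow> ('a::euclidean_space \<Rightarrow> 'b::euclidean_space) \<Rightarrow> bool" where
  "Ck 0 g \<longleftrightarrow> continuous_on UNIV g"
| "Ck (Suc k) g \<longleftrightarrow> g differentiable_on UNIV \<and>
     (\<forall>b\<in>Basis. Ck k (\<lambda>x. frechet_derivative g (at x) b))"

text \<open>Test functions on \<open>\<Omega>\<close> are represented by their extension by zero to the whole space.\<close>

definition test_functions ::
    "'a::euclidean_space set \<Rightarrow> ('a \<Rightarrow> 'b::euclidean_space) set" where
  "test_functions \<Omega> = {v. (\<forall>k. Ck k v) \<and> compact (closure {x. v x \<noteq> 0})
                          \<and> closure {x. v x \<noteq> 0} \<subseteq> \<Omega>}"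

text \<open>A distribution with values in \<open>'b\<close> is represented by its action
  \<open>('a \<Rightarrow> 'b) \<Rightarrow> real\<close>, of which only the values on \<^const>\<open>test_functions\<close> matter.\<close>

definition radon_norm ::
    "'a::euclidean_space set \<Rightarrow> (('a \<Rightarrow> 'b::euclidean_space) \<Rightarrow> real) \<Rightarrow> ereal" where
  "radon_norm \<Omega> T = (SUP v\<in>{v \<in> test_functions \<Omega>. \<forall>x\<in>\<Omega>. norm (v x) \<le> 1}. ereal (T v))"

text \<open>\<open>T\<close> is a finite vector-valued Radon measure: for each \<open>b \<in> Basis\<close> its component is the finite
  signed measure \<open>\<mu> b - \<nu> b\<close>. Regularity need not be required, since every finite Borel measure on
  an open subset of a Euclidean space is Radon.\<close>

definition finite_radon_measure_on ::
    "'a::euclidean_space set \<Rightarrow> (('a \<Rightarrow> 'b::euclidean_space) \<Rightarrow> real) \<Rightarrow> bool" where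
  "finite_radon_measure_on \<Omega> T \<longleftrightarrow>
     (\<exists>\<mu> \<nu> :: 'b \<Rightarrow> 'a measure.
        (\<forall>b\<in>Basis. finite_measure (\<mu> b) \<and> sets (\<mu> b) = sets (restrict_space borel \<Omega>) \<and>
                   finite_measure (\<nu> b) \<and> sets (\<nu> b) = sets (restrict_space borel \<Omega>)) \<and>
        (\<forall>v\<in>test_functions \<Omega>.
           T v = (\<Sum>b\<in>Basis. (LINT x|\<mu> b. v x \<bullet> b) - (LINT x|\<nu> b. v x \<bullet> b))))"

definition partial_deriv :: "'d::finite \<Rightarrow> (real^'d \<Rightarrow> 'b::euclidean_space) \<Rightarrow> real^'d \<Rightarrow> 'b" where
  "partial_deriv j g x = frechet_derivative g (at x) (axis j 1)"

definition dist_of_fun ::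
    "'a::euclidean_space set \<Rightarrow> ('a \<Rightarrow> 'b::euclidean_space) \<Rightarrow> ('a \<Rightarrow> 'b) \<Rightarrow> real" where
  "dist_of_fun \<Omega> w v = (LINT x:\<Omega>|lebesgue. w x \<bullet> v x)"

definition dist_grad ::
    "(real^'d) set \<Rightarrow> (real^'d \<Rightarrow> real) \<Rightarrow> (real^'d \<Rightarrow> real^'d) \<Rightarrow> real" where
  "dist_grad \<Omega> u v = - (LINT x:\<Omega>|lebesgue. u x * (\<Sum>j\<in>UNIV. partial_deriv j v x $ j))"

text \<open>Convention: \<open>(Dw)\<^sub>i\<^sub>j = \<partial>\<^sub>j w\<^sub>i\<close>.\<close>

definition dist_jacobian ::
    "(real^'d) set \<Rightarrow> (real^'d \<Rightarrow> real^'d) \<Rightarrow> (real^'d \<Rightarrow> real^'d^'d) \<Rightarrow> real" where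
  "dist_jacobian \<Omega> w \<phi> =
     - (LINT x:\<Omega>|lebesgue. (\<Sum>i\<in>UNIV. \<Sum>j\<in>UNIV. w x $ i * partial_deriv j \<phi> x $ i $ j))"

text \<open>\<open>(Dw + Dw\<^sup>T) / 2\<close>, where the transpose of a matrix-valued distribution acts by transposing
  the test function.\<close>

definition dist_sym_grad ::
    "(real^'d) set \<Rightarrow> (real^'d \<Rightarrow> real^'d) \<Rightarrow> (real^'d \<Rightarrow> real^'d^'d) \<Rightarrow> real" where
  "dist_sym_grad \<Omega> w \<phi> =
     (dist_jacobian \<Omega> w \<phi> + dist_jacobian \<Omega> w (\<lambda>x. transpose (\<phi> x))) / 2"

definition BV :: "(real^'d) set \<Rightarrow> (real^'d \<Rightarrow> real) set" where
  "BV \<Omega> = {u. set_integrable lebesgue \<Omega> u \<and> finite_radon_measure_on \<Omega> (dist_grad \<Omega> u)}"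

definition BD :: "(real^'d) set \<Rightarrow> (real^'d \<Rightarrow> real^'d) set" where
  "BD \<Omega> = {w. set_integrable lebesgue \<Omega> w \<and> finite_radon_measure_on \<Omega> (dist_sym_grad \<Omega> w)}"

definition L2_norm_sq :: "'a::euclidean_space set \<Rightarrow> ('a \<Rightarrow> real) \<Rightarrow> ennreal" where
  "L2_norm_sq \<Omega> g = (\<integral>\<^sup>+x\<in>\<Omega>. ennreal ((g x)\<^sup>2) \<partial>lebesgue)"

definition L2 :: "'a::euclidean_space set \<Rightarrow> ('a \<Rightarrow> real) set" where
  "L2 \<Omega> = {g. set_borel_measurable lebesgue \<Omega> g \<and> L2_norm_sq \<Omega> g < \<infinity>}"

text \<open>The value is \<open>\<infinity>\<close> where \<open>f - u\<close> is not square integrable (\<open>BV\<close> is not contained in \<open>L2\<close>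
  for general \<open>\<Omega>\<close>).\<close>

definition TGV_objective ::
    "(real^'d) set \<Rightarrow> (real^'d \<Rightarrow> real) \<Rightarrow> real \<Rightarrow> real
       \<Rightarrow> (real^'d \<Rightarrow> real) \<Rightarrow> (real^'d \<Rightarrow> real^'d) \<Rightarrow> ereal" where
  "TGV_objective \<Omega> f \<alpha> \<beta> u w =
     ereal (1/2) * enn2ereal (L2_norm_sq \<Omega> (\<lambda>x. f x - u x))
     + ereal \<alpha> * radon_norm \<Omega> (\<lambda>v. dist_grad \<Omega> u v - dist_of_fun \<Omega> w v)
     + ereal \<beta> * radon_norm \<Omega> (dist_sym_grad \<Omega> w)"

end

theory Submission
  imports Defs
begin

text \<open>
  By minimality, \<open>\<parallel>f - u\<parallel>\<^sup>2 / 2\<close> is at most the objective at any competitor. For \<open>\<alpha> \<rightarrow> 0\<close> the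
  competitor \<open>(f, 0)\<close> has objective \<open>\<alpha> \<parallel>Df\<parallel>\<close>. For \<open>\<beta> \<rightarrow> 0\<close> take \<open>(p, \<nabla>p)\<close> with \<open>p\<close> a polynomial close to
  \<open>f\<close> in \<open>L2\<close>: the middle term vanishes, and \<open>\<beta> \<parallel>\<E>(\<nabla>p)\<parallel>\<close> tends to 0 since \<open>\<nabla>p\<close> is smooth and \<open>\<Omega>\<close> is
  bounded. Because the test functions vanish near the boundary of \<open>\<Omega>\<close>, \<open>p\<close> itself need not have
  compact support, so Stone-Weierstrass replaces mollification.
\<close>

subsection \<open>Integration by parts against test functions\<close>

lemma has_derivative_zero_outside_support:
  assumes "closed K" "\<And>y. y \<notin> K \<Longrightarrow> f y = 0" "x \<notin> K"
  shows "(f has_derivative (\<lambda>_. 0)) (at x)"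
proof (rule has_derivative_transform_within_open[where s="- K" and f="\<lambda>_. 0"])
  show "open (- K)" "x \<in> - K" using assms by auto
  show "0 = f y" if "y \<in> - K" for y using assms(2) that by simp
qed simp

text \<open>The difference quotients of \<open>h\<close> in direction \<open>e\<close> integrate to 0 by translation invariance, and they
  are dominated because \<open>h' x e\<close> is bounded.\<close>

lemma integral_directional_derivative_eq_0:
  fixes h :: "'a::euclidean_space \<Rightarrow> real"
  assumes der: "\<And>x. (h has_derivative h' x) (at x)"
    and cont: "continuous_on UNIV (\<lambda>x. h' x e)"
    and K: "compact K" "\<And>x. x \<notin> K \<Longrightarrow> h x = 0"
  shows "(\<integral>x. h' x e \<partial>lborel) = 0"
proof -
  define D where "D n x = (h (x + (1 / Suc n) *\<^sub>R e) - h x) * Suc n" for n x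
  have h'0: "h' x e = 0" if "x \<notin> K" for x
  proof -
    have "(h has_derivative (\<lambda>_. 0)) (at x)"
      using K that compact_imp_closed by (intro has_derivative_zero_outside_support) auto
    from has_derivative_unique[OF der this] show ?thesis by simp
  qed
  \<comment> \<open>The directional derivative vanishes off the compact \<open>K\<close> and is
    continuous on it, so one bound \<open>B\<close> holds on the whole space.\<close>
  obtain B where B: "\<And>x. \<bar>h' x e\<bar> \<le> B" "B \<ge> 0"
  proof -
    have "bounded ((\<lambda>x. h' x e) ` K)"
      by (intro compact_imp_bounded compact_continuous_image continuous_on_subset[OF cont] K) auto
    then obtain B where "\<And>x. x \<in> K \<Longrightarrow> \<bar>h' x e\<bar> \<le> B" "B > 0"
      unfolding bounded_pos by auto
    then show ?thesis using that[of B] h'0 by (metis abs_zero less_eq_real_def)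
  qed
  have hc: "continuous_on UNIV h"
    using der by (meson continuous_at_imp_continuous_on has_derivative_continuous)
  have meas: "h \<in> borel_measurable borel" "(\<lambda>x. h' x e) \<in> borel_measurable borel"
    using hc cont by (auto intro: borel_measurable_continuous_onI)
  have "(\<lambda>x. indicator K x *\<^sub>R h x) = h"
    using K(2) by (auto simp: indicator_def fun_eq_iff)
  then have hint: "integrable lborel h"
    using borel_integrable_compact[OF K(1) continuous_on_subset[OF hc]] by simp
  have trans: "integrable lborel (\<lambda>x. h (x + c))" "(\<integral>x. h (x + c) \<partial>lborel) = (\<integral>x. h x \<partial>lborel)" for c
  proof -
    have "integrable (distr lborel borel ((+) c)) h" using hint by (simp add: lborel_distr_plus)
    then show "integrable lborel (\<lambda>x. h (x + c))"
      using meas by (simp add: integrable_distr_eq add.commute)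
    have "(\<integral>x. h x \<partial>lborel) = integral\<^sup>L (distr lborel borel ((+) c)) h"
      by (simp add: lborel_distr_plus)
    also have "\<dots> = (\<integral>x. h (c + x) \<partial>lborel)"
      by (rule integral_distr) (use meas in auto)
    finally show "(\<integral>x. h (x + c) \<partial>lborel) = (\<integral>x. h x \<partial>lborel)" by (simp add: add.commute)
  qed
  have D0: "(\<integral>x. D n x \<partial>lborel) = 0" for n
    unfolding D_def using trans hint by simp
  \<comment> \<open>\<open>K'\<close> is swept out by moving \<open>K\<close> backwards along
    \<open>e\<close> over a unit length. All steps \<open>1 / Suc n\<close> are at most 1, so for
    \<open>x\<close> outside \<open>K'\<close> both \<open>x\<close> and its translate miss
    \<open>K\<close>. Since \<open>K'\<close> is compact, a single integrable majorant serves every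
    \<open>n\<close>.\<close>
  define K' where "K' = (\<lambda>(x, s). x - s *\<^sub>R e) ` (K \<times> {0..1::real})"
  have K': "compact K'" unfolding K'_def
    by (intro compact_continuous_image compact_Times K) (auto intro!: continuous_intros simp: case_prod_unfold)
  have Dle: "\<bar>D n x\<bar> \<le> B * indicator K' x" for n x
  proof (cases "x \<in> K'")
    case True
    \<comment> \<open>Mean value theorem along the segment: dividing by the step turns
      \<open>D n x\<close> into a value of the directional derivative at an intermediate point,
      which \<open>B\<close> bounds.\<close>
    have "\<exists>t\<in>{0<..<1 / real (Suc n)}. h (x + (1 / Suc n) *\<^sub>R e) - h (x + 0 *\<^sub>R e) = h' (x + t *\<^sub>R e) ((1 / Suc n - 0) *\<^sub>R e)"
      by (rule mvt_simple[where f="\<lambda>t. h (x + t *\<^sub>R e)"])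
        (auto intro!: derivative_eq_intros has_derivative_compose[OF _ der, THEN has_derivative_at_withinI])
    then obtain t where "h (x + (1 / Suc n) *\<^sub>R e) - h x = h' (x + t *\<^sub>R e) ((1 / Suc n) *\<^sub>R e)" by auto
    also have "\<dots> = (1 / Suc n) * h' (x + t *\<^sub>R e) e"
      by (simp add: has_derivative_linear[OF der] linear_cmul)
    finally have "D n x = h' (x + t *\<^sub>R e) e" by (simp add: D_def)
    then show ?thesis using B True by simp
  next
    case False
    have "x + s *\<^sub>R e \<notin> K" if "s \<in> {0..1}" for s
      using False that unfolding K'_def by (force simp: image_iff)
    \<comment> \<open>The two instances treat the two endpoints of the difference quotient.\<close>
    from this[of 0] this[of "1 / Suc n"] have "D n x = 0" by (auto simp: D_def K(2))
    then show ?thesis using False by simp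
  qed
  have lim: "(\<lambda>n. D n x) \<longlonglongrightarrow> h' x e" for x
  proof -
    have "((\<lambda>t::real. x + t *\<^sub>R e) has_derivative (\<lambda>t. t *\<^sub>R e)) (at 0)"
      by (auto intro!: derivative_eq_intros)
    moreover have "(h has_derivative h' x) (at (x + 0 *\<^sub>R e))"
      using der by simp
    ultimately have "((\<lambda>t. h (x + t *\<^sub>R e)) has_derivative (\<lambda>t. h' x (t *\<^sub>R e))) (at 0)"
      by (rule has_derivative_compose)
    moreover have "(\<lambda>t. h' x (t *\<^sub>R e)) = (*) (h' x e)"
      using linear_cmul[OF has_derivative_linear[OF der]] by (simp add: fun_eq_iff)
    ultimately have "((\<lambda>t. h (x + t *\<^sub>R e)) has_real_derivative h' x e) (at 0)"
      by (simp add: has_field_derivative_def)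
    then have "((\<lambda>t. (h (x + t *\<^sub>R e) - h x) / t) \<longlongrightarrow> h' x e) (at 0)"
      by (simp add: DERIV_def)
    from filterlim_compose[OF this, of "\<lambda>n. 1 / real (Suc n)" sequentially]
    show ?thesis
      using LIMSEQ_inverse_real_of_nat by (simp add: D_def filterlim_at inverse_eq_divide)
  qed
  have "(\<lambda>n. \<integral>x. D n x \<partial>lborel) \<longlonglongrightarrow> (\<integral>x. h' x e \<partial>lborel)"
  proof (rule integral_dominated_convergence[where w="\<lambda>x. B * indicator K' x"])
    show "integrable lborel (\<lambda>x. B * indicator K' x)"
      using borel_integrable_compact[OF K', of "\<lambda>_. B"] by (simp add: mult.commute)
    show "D n \<in> borel_measurable lborel" for n
      unfolding D_def[abs_def] using trans(1)[of "(1 / Suc n) *\<^sub>R e"] hint by (auto intro: borel_measurable_integrable)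
  qed (use meas lim Dle in auto)
  then show ?thesis using D0 by (simp add: LIMSEQ_const_iff)
qed

section \<open>Derivatives of polynomials\<close>

lemma real_polynomial_function_differentiable:
  assumes "real_polynomial_function p"
  shows "p differentiable at x"
  using assms differentiable_at_polynomial_function real_polynomial_function_eq by blast

text \<open>Induction on how a polynomial is built: a linear function has a constant derivative, and
  the sum and product rules do the rest. Iterating gives continuous first and second derivatives,
  the regularity that the competitor \<open>(p, \<nabla>p)\<close> has to offer.\<close>

lemma real_polynomial_function_frechet_derivative:
  fixes p :: "'a::euclidean_space \<Rightarrow> real"
  assumes "real_polynomial_function p"
  shows "real_polynomial_function (\<lambda>x. frechet_derivative p (at x) e)"
  using assms
proof induction
  case (linear f)
  then have "frechet_derivative f (at x) = f" for x
    using frechet_derivative_at bounded_linear_imp_has_derivative by metis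
  then show ?case by auto
next
  case (const c)
  then show ?case by auto
next
  case (add f g)
  have "frechet_derivative (\<lambda>x. f x + g x) (at x) e =
      frechet_derivative f (at x) e + frechet_derivative g (at x) e" for x
    using add.hyps by (subst frechet_derivative_at[OF has_derivative_add, symmetric])
      (auto simp: real_polynomial_function_differentiable frechet_derivative_works[symmetric])
  then show ?case using add by auto
next
  case (mult f g)
  have "frechet_derivative (\<lambda>x. f x * g x) (at x) e =
      f x * frechet_derivative g (at x) e + frechet_derivative f (at x) e * g x" for x
    using mult.hyps by (subst frechet_derivative_at[OF has_derivative_mult, symmetric])
      (auto simp: real_polynomial_function_differentiable frechet_derivative_works[symmetric])
  then show ?case using mult by auto
qed

section \<open>Regularity and support of test functions\<close>

lemma test_functions_differentiable:
  assumes "v \<in> test_functions \<Omega>"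
  shows "v differentiable at x"
proof -
  have "Ck 1 v" using assms by (auto simp: test_functions_def simp del: One_nat_def)
  then show ?thesis by (simp add: differentiable_on_def)
qed

lemma test_functions_continuous:
  assumes "v \<in> test_functions \<Omega>"
  shows "continuous_on UNIV v"
  using test_functions_differentiable[OF assms]
  by (meson continuous_at_imp_continuous_on differentiable_imp_continuous_within)

lemma test_functions_continuous_frechet_derivative:
  assumes "v \<in> test_functions \<Omega>" "e \<in> Basis"
  shows "continuous_on UNIV (\<lambda>x. frechet_derivative v (at x) e)"
proof -
  have "Ck (Suc 0) v" using assms by (auto simp: test_functions_def simp del: One_nat_def)
  then show ?thesis using assms by simp
qed

lemma test_functions_support:
  assumes "v \<in> test_functions \<Omega>"
  obtains K where "compact K" "K \<subseteq> \<Omega>" "\<And>x. x \<notin> K \<Longrightarrow> v x = 0"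
proof
  show "compact (closure {x. v x \<noteq> 0})" "closure {x. v x \<noteq> 0} \<subseteq> \<Omega>"
    using assms by (auto simp: test_functions_def)
  show "v x = 0" if "x \<notin> closure {x. v x \<noteq> 0}" for x
    using that closure_subset[of "{x. v x \<noteq> 0}"] by auto
qed

lemma zero_in_test_functions: "(\<lambda>_. 0) \<in> test_functions \<Omega>"
proof -
  have "Ck k (\<lambda>_::'a. 0::'b)" for k by (induction k) auto
  then show ?thesis by (simp add: test_functions_def)
qed

text \<open>A function that vanishes off a compact subset of \<Omega> is unchanged by the indicator
  of \<Omega>. This turns integrals over \<Omega> into integrals over the whole space, where
  translation invariance is available.\<close>

lemma integrable_continuous_supported:
  fixes h :: "'a::euclidean_space \<Rightarrow> real"
  assumes "continuous_on UNIV h" "compact K" "K \<subseteq> \<Omega>" "\<And>x. x \<notin> K \<Longrightarrow> h x = 0"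
  shows "set_integrable lebesgue \<Omega> h" and "(LINT x:\<Omega>|lebesgue. h x) = (\<integral>x. h x \<partial>lborel)"
proof -
  have eq: "(\<lambda>x. indicator \<Omega> x *\<^sub>R h x) = h" "(\<lambda>x. indicator K x *\<^sub>R h x) = h"
    using assms by (force simp: indicator_def)+
  have m: "h \<in> borel_measurable lborel" using assms by (auto intro: borel_measurable_continuous_onI)
  have "integrable lborel h"
    using borel_integrable_compact[OF assms(2) continuous_on_subset[OF assms(1)]] eq by simp
  then show "set_integrable lebesgue \<Omega> h"
    unfolding set_integrable_def eq using m by (simp add: integrable_completion)
  show "(LINT x:\<Omega>|lebesgue. h x) = (\<integral>x. h x \<partial>lborel)"
    unfolding set_lebesgue_integral_def eq using m by (simp add: integral_completion)
qed

text \<open>The product \<open>g x * (v x \<bullet> b)\<close> inherits compact support from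
  \<open>v\<close>, whatever \<open>g\<close> does near the boundary. Its directional derivative
  therefore integrates to 0, and the product rule splits that integral in two.\<close>

lemma test_function_integration_by_parts:
  fixes g :: "'a::euclidean_space \<Rightarrow> real" and v :: "'a \<Rightarrow> 'b::euclidean_space"
  assumes v: "v \<in> test_functions \<Omega>" and e: "e \<in> Basis"
    and g: "\<And>x. g differentiable at x" "continuous_on UNIV (\<lambda>x. frechet_derivative g (at x) e)"
  shows "set_integrable lebesgue \<Omega> (\<lambda>x. g x * (frechet_derivative v (at x) e \<bullet> b))" (is ?A)
    and "set_integrable lebesgue \<Omega> (\<lambda>x. frechet_derivative g (at x) e * (v x \<bullet> b))" (is ?B)
    and "(LINT x:\<Omega>|lebesgue. g x * (frechet_derivative v (at x) e \<bullet> b)) =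
         - (LINT x:\<Omega>|lebesgue. frechet_derivative g (at x) e * (v x \<bullet> b))" (is ?C)
proof -
  let ?p = "\<lambda>x. g x * (frechet_derivative v (at x) e \<bullet> b)"
  let ?q = "\<lambda>x. frechet_derivative g (at x) e * (v x \<bullet> b)"
  obtain K where K: "compact K" "K \<subseteq> \<Omega>" and v0: "\<And>x. x \<notin> K \<Longrightarrow> v x = 0"
    using test_functions_support[OF v] by metis
  have dv0: "frechet_derivative v (at x) e = 0" if "x \<notin> K" for x
  proof -
    have "(v has_derivative (\<lambda>_. 0)) (at x)"
      by (rule has_derivative_zero_outside_support[OF compact_imp_closed[OF K(1)] v0 that])
    from frechet_derivative_at[OF this, symmetric] show ?thesis by simp
  qed
  have gc: "continuous_on UNIV g"
    using g(1) by (meson continuous_at_imp_continuous_on differentiable_imp_continuous_within)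
  have cp: "continuous_on UNIV ?p" and cq: "continuous_on UNIV ?q"
    using gc g(2) test_functions_continuous[OF v] test_functions_continuous_frechet_derivative[OF v e]
    by (auto intro!: continuous_intros)
  note P = integrable_continuous_supported[OF cp K] and Q = integrable_continuous_supported[OF cq K]
  show A: ?A and B: ?B using P(1) Q(1) v0 dv0 by auto
  have "(LINT x:\<Omega>|lebesgue. ?p x + ?q x) = (\<integral>x. ?p x + ?q x \<partial>lborel)"
    by (rule integrable_continuous_supported[OF _ K]) (use cp cq v0 dv0 in \<open>auto intro!: continuous_intros\<close>)
  also have "\<dots> = 0"
  proof (rule integral_directional_derivative_eq_0[OF _ _ K(1)])
    show "((\<lambda>x. g x * (v x \<bullet> b)) has_derivative
        (\<lambda>d. g x * (frechet_derivative v (at x) d \<bullet> b) + frechet_derivative g (at x) d * (v x \<bullet> b))) (at x)" for x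
      using g(1) test_functions_differentiable[OF v]
      by (auto intro!: derivative_eq_intros simp: frechet_derivative_works[symmetric])
  qed (use cp cq v0 in \<open>auto intro!: continuous_intros\<close>)
  finally show ?C using set_integral_add(2)[OF A B] by simp
qed

subsection \<open>Distributions given by continuous functions\<close>

lemma set_integral_sum:
  fixes f :: "'i \<Rightarrow> 'a \<Rightarrow> real"
  assumes "\<And>i. i \<in> I \<Longrightarrow> set_integrable M A (f i)"
  shows "(LINT x:A|M. (\<Sum>i\<in>I. f i x)) = (\<Sum>i\<in>I. LINT x:A|M. f i x)"
  using assms unfolding set_lebesgue_integral_def set_integrable_def
  by (simp add: scaleR_sum_right del: real_scaleR_def)

section \<open>Test functions under linear maps\<close>

lemma frechet_derivative_bounded_linear_compose:
  assumes "bounded_linear L" "g differentiable at x"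
  shows "frechet_derivative (\<lambda>x. L (g x)) (at x) = (\<lambda>d. L (frechet_derivative g (at x) d))"
  using bounded_linear.has_derivative[OF assms(1) frechet_derivative_works[THEN iffD1, OF assms(2)]]
  by (rule frechet_derivative_at[symmetric])

text \<open>Differentiating \<open>L (g x)\<close> gives \<open>L\<close> applied to the derivative
  of \<open>g\<close>, so the induction repeats the same situation one order lower.\<close>

lemma Ck_bounded_linear_compose:
  assumes "bounded_linear L" "Ck k g"
  shows "Ck k (\<lambda>x. L (g x))"
  using assms(2)
proof (induction k arbitrary: g)
  case 0
  then show ?case using assms(1) by (simp add: bounded_linear.continuous_on)
next
  case (Suc k)
  then have d: "g differentiable at x" for x by (simp add: differentiable_on_def)
  have "(\<lambda>x. L (g x)) differentiable at x" for x
    using assms(1) d bounded_linear.has_derivative unfolding differentiable_def by blast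
  then show ?case
    using Suc by (simp add: frechet_derivative_bounded_linear_compose[OF assms(1) d] differentiable_on_def)
qed

text \<open>A linear map sends 0 to 0, so the support can only shrink. Applied to transposition,
  this makes the second term of \<open>dist_sym_grad\<close> an evaluation at a test
  function.\<close>

lemma test_functions_bounded_linear_compose:
  assumes "bounded_linear L" "v \<in> test_functions \<Omega>"
  shows "(\<lambda>x. L (v x)) \<in> test_functions \<Omega>"
proof -
  have "{x. L (v x) \<noteq> 0} \<subseteq> {x. v x \<noteq> 0}"
    using bounded_linear.linear[OF assms(1)] linear_0 by fastforce
  from closure_mono[OF this] show ?thesis
    using assms(2) Ck_bounded_linear_compose[OF assms(1)]
    by (auto simp: test_functions_def compact_eq_bounded_closed intro: bounded_subset)
qed


lemma bounded_linear_transpose: "bounded_linear (transpose :: real^'n^'m \<Rightarrow> real^'m^'n)"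
  by (subst linear_conv_bounded_linear[symmetric], rule linearI) (vector transpose_def)+

lemma inner_transpose:
  fixes A :: "real^'n^'m"
  shows "A \<bullet> transpose B = transpose A \<bullet> B"
  by (simp add: inner_vec_def transpose_def) (rule sum.swap)

text \<open>Each component \<open>v x $ j\<close> is the inner product with \<open>axis j 1\<close>,
  so integration by parts applies to every summand of the divergence; the two minus signs
  cancel.\<close>

lemma dist_grad_eq_dist_of_fun:
  fixes g :: "real^'d \<Rightarrow> real"
  assumes "\<And>x. g differentiable at x" "\<And>j. continuous_on UNIV (partial_deriv j g)"
    and v: "v \<in> test_functions \<Omega>"
  shows "dist_grad \<Omega> g v = dist_of_fun \<Omega> (\<lambda>x. \<chi> j. partial_deriv j g x) v"
proof -
  have c: "continuous_on UNIV (\<lambda>x. frechet_derivative g (at x) (axis j 1))" for j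
    using assms(2)[of j] by (simp add: partial_deriv_def[abs_def])
  have ax: "axis j (1::real) \<in> Basis" for j :: 'd by (simp add: axis_in_Basis_iff)
  note ibp = test_function_integration_by_parts[OF v ax assms(1) c]
  have "dist_grad \<Omega> g v =
      - (LINT x:\<Omega>|lebesgue. (\<Sum>j\<in>UNIV. g x * (frechet_derivative v (at x) (axis j 1) \<bullet> axis j 1)))"
    by (simp add: dist_grad_def partial_deriv_def inner_axis sum_distrib_left)
  also have "\<dots> = (\<Sum>j\<in>UNIV. LINT x:\<Omega>|lebesgue. frechet_derivative g (at x) (axis j 1) * (v x \<bullet> axis j 1))"
    by (subst set_integral_sum) (simp_all add: ibp sum_negf)
  also have "\<dots> = (LINT x:\<Omega>|lebesgue. (\<Sum>j\<in>UNIV. frechet_derivative g (at x) (axis j 1) * (v x \<bullet> axis j 1)))"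
    by (rule set_integral_sum[symmetric]) (rule ibp)
  also have "\<dots> = dist_of_fun \<Omega> (\<lambda>x. \<chi> j. partial_deriv j g x) v"
    by (simp add: dist_of_fun_def partial_deriv_def inner_axis) (simp add: inner_vec_def)
  finally show ?thesis .
qed

lemma dist_jacobian_eq_dist_of_fun:
  fixes w :: "real^'d \<Rightarrow> real^'d"
  assumes "\<And>i x. (\<lambda>y. w y $ i) differentiable at x"
    and "\<And>i j. continuous_on UNIV (partial_deriv j (\<lambda>y. w y $ i))"
    and v: "v \<in> test_functions \<Omega>"
  shows "dist_jacobian \<Omega> w v = dist_of_fun \<Omega> (\<lambda>x. \<chi> i j. partial_deriv j (\<lambda>y. w y $ i) x) v"
proof -
  have c: "continuous_on UNIV (\<lambda>x. frechet_derivative (\<lambda>y. w y $ i) (at x) (axis j 1))" for i j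
    using assms(2)[of j i] by (simp add: partial_deriv_def[abs_def])
  have ax: "axis j (1::real) \<in> Basis" for j :: 'd by (simp add: axis_in_Basis_iff)
  note ibp = test_function_integration_by_parts[OF v ax assms(1) c]
  let ?p = "\<lambda>i j x. w x $ i * (frechet_derivative v (at x) (axis j 1) \<bullet> axis i (axis j 1))"
  let ?q = "\<lambda>i j x. frechet_derivative (\<lambda>y. w y $ i) (at x) (axis j 1) * (v x \<bullet> axis i (axis j 1))"
  \<comment> \<open>The double sum becomes one sum over index pairs, so that sum and integral are
    exchanged only once. The matrix entry \<open>(i, j)\<close> is the inner product with
    \<open>axis i (axis j 1)\<close>.\<close>
  have "dist_jacobian \<Omega> w v = - (LINT x:\<Omega>|lebesgue. (\<Sum>(i, j)\<in>UNIV. ?p i j x))"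
    by (simp add: dist_jacobian_def partial_deriv_def inner_axis sum.cartesian_product)
  also have "\<dots> = (\<Sum>(i, j)\<in>UNIV. LINT x:\<Omega>|lebesgue. ?q i j x)"
    unfolding case_prod_unfold by (subst set_integral_sum) (simp_all add: ibp sum_negf)
  also have "\<dots> = (LINT x:\<Omega>|lebesgue. (\<Sum>(i, j)\<in>UNIV. ?q i j x))"
    unfolding case_prod_unfold by (rule set_integral_sum[symmetric]) (rule ibp)
  also have "\<dots> = dist_of_fun \<Omega> (\<lambda>x. \<chi> i j. partial_deriv j (\<lambda>y. w y $ i) x) v"
    by (simp add: dist_of_fun_def partial_deriv_def inner_axis) (simp add: inner_vec_def sum.cartesian_product)
  finally show ?thesis .
qed

lemma set_integrable_inner_test_function:
  assumes "continuous_on UNIV G" "v \<in> test_functions \<Omega>"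
  shows "set_integrable lebesgue \<Omega> (\<lambda>x. G x \<bullet> v x)"
proof -
  obtain K where K: "compact K" "K \<subseteq> \<Omega>" and v0: "\<And>x. x \<notin> K \<Longrightarrow> v x = 0"
    using test_functions_support[OF assms(2)] by metis
  show ?thesis
    by (rule integrable_continuous_supported(1)[OF _ K])
      (auto intro!: continuous_intros assms(1) test_functions_continuous[OF assms(2)] simp: v0)
qed

text \<open>Transposition is self-adjoint for the inner product of matrices, so it passes from the
  test function to the Jacobian, and the average is the symmetric part of \<open>J\<close>.\<close>

lemma dist_sym_grad_eq_dist_of_fun:
  fixes w :: "real^'d \<Rightarrow> real^'d"
  assumes "\<And>i x. (\<lambda>y. w y $ i) differentiable at x"
    and "\<And>i j. continuous_on UNIV (partial_deriv j (\<lambda>y. w y $ i))"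
    and v: "v \<in> test_functions \<Omega>"
  defines "J \<equiv> \<lambda>x. \<chi> i j. partial_deriv j (\<lambda>y. w y $ i) x"
  shows "dist_sym_grad \<Omega> w v = dist_of_fun \<Omega> (\<lambda>x. (1/2) *\<^sub>R (J x + transpose (J x))) v"
proof -
  have J: "continuous_on UNIV J"
    unfolding J_def by (intro continuous_intros assms)
  have v': "(\<lambda>x. transpose (v x)) \<in> test_functions \<Omega>"
    using test_functions_bounded_linear_compose[OF bounded_linear_transpose v] .
  note int = set_integrable_inner_test_function[OF J v] set_integrable_inner_test_function[OF J v']
  have "dist_sym_grad \<Omega> w v = (dist_of_fun \<Omega> J v + dist_of_fun \<Omega> J (\<lambda>x. transpose (v x))) / 2"
    unfolding dist_sym_grad_def J_def using dist_jacobian_eq_dist_of_fun[OF assms(1,2)] v v' by simp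
  also have "\<dots> = (LINT x:\<Omega>|lebesgue. (1/2) * (J x \<bullet> v x + J x \<bullet> transpose (v x)))"
    by (simp add: set_integral_add(2)[OF int] dist_of_fun_def)
  also have "\<dots> = dist_of_fun \<Omega> (\<lambda>x. (1/2) *\<^sub>R (J x + transpose (J x))) v"
    by (simp add: dist_of_fun_def inner_add_left inner_transpose)
  finally show ?thesis .
qed

text \<open>The component measures are the positive and negative parts of \<open>G x \<bullet> b\<close>, taken as densities.\<close>

lemma finite_radon_measure_on_dist_of_fun:
  fixes G :: "'a::euclidean_space \<Rightarrow> 'b::euclidean_space"
  assumes \<Omega>: "open \<Omega>" "bounded \<Omega>" and G: "continuous_on UNIV G"
    and T: "\<And>v. v \<in> test_functions \<Omega> \<Longrightarrow> T v = dist_of_fun \<Omega> G v"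
  shows "finite_radon_measure_on \<Omega> T"
proof -
  let ?M = "restrict_space lborel \<Omega>"
  \<comment> \<open>The choice \<open>s = 1\<close> yields the positive part of the density and
    \<open>s = -1\<close> the negative part.\<close>
  define P where "P s b = density ?M (\<lambda>x. ennreal (max 0 (s * (G x \<bullet> b))))" for s b
  have meas[measurable]: "(\<lambda>x. max 0 (s * (G x \<bullet> b))) \<in> borel_measurable ?M" for s b
  proof -
    have "continuous_on UNIV (\<lambda>x. max 0 (s * (G x \<bullet> b)))"
      using G by (intro continuous_intros)
    then show ?thesis
      by (intro measurable_restrict_space1) (simp add: borel_measurable_continuous_onI)
  qed
  \<comment> \<open>On the compact closure of \<Omega> the continuous \<open>G\<close> is bounded;
    as \<Omega> has finite volume, the densities have finite mass.\<close>
  have "bounded (G ` closure \<Omega>)"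
    using \<Omega> by (intro compact_imp_bounded compact_continuous_image continuous_on_subset[OF G])
      (auto simp: compact_closure)
  then obtain B where B: "\<And>x. x \<in> \<Omega> \<Longrightarrow> norm (G x) \<le> B" "B > 0"
    unfolding bounded_pos using closure_subset by blast
  have fin: "finite_measure (P s b)" if "b \<in> Basis" "\<bar>s\<bar> = 1" for s b
  proof
    have "emeasure (P s b) (space (P s b)) = (\<integral>\<^sup>+x. ennreal (max 0 (s * (G x \<bullet> b))) \<partial>?M)"
      unfolding P_def by (subst emeasure_density) (auto intro!: nn_integral_cong)
    also have "\<dots> \<le> (\<integral>\<^sup>+x. ennreal B \<partial>?M)"
    proof (intro nn_integral_mono ennreal_leI)
      fix x assume "x \<in> space ?M"
      then have "x \<in> \<Omega>" by (simp add: space_restrict_space)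
      then have "\<bar>s * (G x \<bullet> b)\<bar> \<le> B"
        using that B(1)[of x] Basis_le_norm[of b "G x"] by (simp add: abs_mult)
      then show "max 0 (s * (G x \<bullet> b)) \<le> B" using B(2) by linarith
    qed
    also have "\<dots> = B * emeasure lborel \<Omega>"
      using \<Omega> by (simp add: emeasure_restrict_space space_restrict_space)
    also have "\<dots> < \<infinity>"
      using emeasure_bounded_finite[OF \<Omega>(2)] by (simp add: ennreal_mult_less_top)
    finally show "emeasure (P s b) (space (P s b)) \<noteq> \<infinity>" by simp
  qed
  have integral_P: "(LINT x|P s b. v x \<bullet> b) = (LINT x:\<Omega>|lebesgue. max 0 (s * (G x \<bullet> b)) * (v x \<bullet> b))"
    "set_integrable lebesgue \<Omega> (\<lambda>x. max 0 (s * (G x \<bullet> b)) * (v x \<bullet> b))"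
    if v: "v \<in> test_functions \<Omega>" for v :: "'a \<Rightarrow> 'b" and s b
  proof -
    obtain K where K: "compact K" "K \<subseteq> \<Omega>" and v0: "\<And>x. x \<notin> K \<Longrightarrow> v x = 0"
      using test_functions_support[OF v] by metis
    have vc: "continuous_on UNIV (\<lambda>x. v x \<bullet> b)"
      using test_functions_continuous[OF v] by (intro continuous_intros)
    have c: "continuous_on UNIV (\<lambda>x. max 0 (s * (G x \<bullet> b)) * (v x \<bullet> b))"
      by (intro continuous_on_mult vc) (intro continuous_intros G)
    note I = integrable_continuous_supported[OF c K]
    have m: "(\<lambda>x. v x \<bullet> b) \<in> borel_measurable ?M"
      using vc by (intro measurable_restrict_space1) (simp add: borel_measurable_continuous_onI)
    have "(LINT x|P s b. v x \<bullet> b) = (LINT x|?M. max 0 (s * (G x \<bullet> b)) *\<^sub>R (v x \<bullet> b))"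
      unfolding P_def using m by (intro integral_density) auto
    also have "\<dots> = (LINT x|lborel. indicator \<Omega> x *\<^sub>R (max 0 (s * (G x \<bullet> b)) *\<^sub>R (v x \<bullet> b)))"
      using \<Omega> by (intro integral_restrict_space) auto
    also have "\<dots> = (LINT x|lborel. max 0 (s * (G x \<bullet> b)) * (v x \<bullet> b))"
    proof (intro Bochner_Integration.integral_cong refl)
      show "indicator \<Omega> x *\<^sub>R (max 0 (s * (G x \<bullet> b)) *\<^sub>R (v x \<bullet> b)) = max 0 (s * (G x \<bullet> b)) * (v x \<bullet> b)" for x
      proof (cases "x \<in> \<Omega>")
        case False
        then have "v x = 0" using K(2) v0 by blast
        then show ?thesis by simp
      qed simp
    qed
    also have "\<dots> = (LINT x:\<Omega>|lebesgue. max 0 (s * (G x \<bullet> b)) * (v x \<bullet> b))"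
      using I(2) v0 by simp
    finally show "(LINT x|P s b. v x \<bullet> b) = (LINT x:\<Omega>|lebesgue. max 0 (s * (G x \<bullet> b)) * (v x \<bullet> b))" .
    show "set_integrable lebesgue \<Omega> (\<lambda>x. max 0 (s * (G x \<bullet> b)) * (v x \<bullet> b))"
      using I(1) v0 by simp
  qed
  have "T v = (\<Sum>b\<in>Basis. (LINT x|P 1 b. v x \<bullet> b) - (LINT x|P (-1) b. v x \<bullet> b))"
    if v: "v \<in> test_functions \<Omega>" for v
  proof -
    have pos_neg: "G x \<bullet> v x = (\<Sum>b\<in>Basis.
        max 0 (1 * (G x \<bullet> b)) * (v x \<bullet> b) - max 0 (- 1 * (G x \<bullet> b)) * (v x \<bullet> b))" for x
    proof -
      have "a * c = max 0 (1 * a) * c - max 0 (- 1 * a) * c" for a c :: real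
        by (auto simp: max_def)
      then show ?thesis
        unfolding euclidean_inner[of "G x" "v x"] by (intro sum.cong refl)
    qed
    have "T v = (LINT x:\<Omega>|lebesgue. (\<Sum>b\<in>Basis.
        max 0 (1 * (G x \<bullet> b)) * (v x \<bullet> b) - max 0 (- 1 * (G x \<bullet> b)) * (v x \<bullet> b)))"
      unfolding T[OF v] dist_of_fun_def pos_neg ..
    also have "\<dots> = (\<Sum>b\<in>Basis. LINT x:\<Omega>|lebesgue.
        max 0 (1 * (G x \<bullet> b)) * (v x \<bullet> b) - max 0 (- 1 * (G x \<bullet> b)) * (v x \<bullet> b))"
      by (rule set_integral_sum) (rule set_integral_diff(1)[OF integral_P(2)[OF v] integral_P(2)[OF v]])
    also have "\<dots> = (\<Sum>b\<in>Basis. (LINT x|P 1 b. v x \<bullet> b) - (LINT x|P (-1) b. v x \<bullet> b))"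
      by (simp only: integral_P(1)[OF v] set_integral_diff(2)[OF integral_P(2)[OF v] integral_P(2)[OF v]])
    finally show ?thesis .
  qed
  moreover have "sets (P s b) = sets (restrict_space borel \<Omega>)" for s b
    by (simp add: P_def sets_restrict_space)
  ultimately show ?thesis
    unfolding finite_radon_measure_on_def using fin
    by (intro exI[of _ "P 1"] exI[of _ "P (-1)"]) auto
qed

text \<open>For an admissible test function every component satisfies
  \<open>\<bar>v x \<bullet> b\<bar> \<le> 1\<close>, so the masses of all component measures
  together bound the supremum.\<close>

lemma radon_norm_finite:
  assumes "finite_radon_measure_on \<Omega> T"
  shows "radon_norm \<Omega> T < \<infinity>"
proof -
  obtain \<mu> \<nu> :: "'b \<Rightarrow> 'a measure" where
    m: "\<forall>b\<in>Basis. finite_measure (\<mu> b) \<and> sets (\<mu> b) = sets (restrict_space borel \<Omega>) \<and>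
          finite_measure (\<nu> b) \<and> sets (\<nu> b) = sets (restrict_space borel \<Omega>)" and
    T: "\<forall>v\<in>test_functions \<Omega>.
         T v = (\<Sum>b\<in>Basis. (LINT x|\<mu> b. v x \<bullet> b) - (LINT x|\<nu> b. v x \<bullet> b))"
    using assms unfolding finite_radon_measure_on_def by blast
  have bound: "\<bar>LINT x|M. v x \<bullet> b\<bar> \<le> measure M (space M)"
    if "finite_measure M" "sets M = sets (restrict_space borel \<Omega>)" "b \<in> Basis" "\<forall>x\<in>\<Omega>. norm (v x) \<le> 1"
    for M and v :: "'a \<Rightarrow> 'b" and b
  proof (cases "integrable M (\<lambda>x. v x \<bullet> b)")
    case True
    interpret finite_measure M by fact
    have "space M = \<Omega>"
      using sets_eq_imp_space_eq[OF that(2)] by (simp add: space_restrict_space)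
    then have le: "\<bar>v x \<bullet> b\<bar> \<le> 1" if "x \<in> space M" for x
      using \<open>\<forall>x\<in>\<Omega>. norm (v x) \<le> 1\<close> Basis_le_norm[OF \<open>b \<in> Basis\<close>, of "v x"] that by fastforce
    have "\<bar>LINT x|M. v x \<bullet> b\<bar> \<le> (LINT x|M. \<bar>v x \<bullet> b\<bar>)"
      using integral_norm_bound[of M "\<lambda>x. v x \<bullet> b"] by simp
    also have "\<dots> \<le> (LINT x|M. 1)"
      using True le by (intro integral_mono) auto
    finally show ?thesis by simp
  next
    \<comment> \<open>The integral of a function that is not integrable is 0 by convention, so the
      bound persists.\<close>
    case False
    then show ?thesis by (simp add: not_integrable_integral_eq)
  qed
  define C where "C = (\<Sum>b\<in>Basis. measure (\<mu> b) (space (\<mu> b)) + measure (\<nu> b) (space (\<nu> b)))"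
  have "T v \<le> C" if "v \<in> test_functions \<Omega>" "\<forall>x\<in>\<Omega>. norm (v x) \<le> 1" for v
    unfolding bspec[OF T that(1)] C_def
  proof (rule sum_mono)
    fix b :: 'b assume b: "b \<in> Basis"
    have "\<bar>LINT x|\<mu> b. v x \<bullet> b\<bar> \<le> measure (\<mu> b) (space (\<mu> b))"
      by (rule bound[OF _ _ b that(2)]) (use m b in blast)+
    moreover have "\<bar>LINT x|\<nu> b. v x \<bullet> b\<bar> \<le> measure (\<nu> b) (space (\<nu> b))"
      by (rule bound[OF _ _ b that(2)]) (use m b in blast)+
    ultimately show "(LINT x|\<mu> b. v x \<bullet> b) - (LINT x|\<nu> b. v x \<bullet> b)
        \<le> measure (\<mu> b) (space (\<mu> b)) + measure (\<nu> b) (space (\<nu> b))"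
      by linarith
  qed
  then have "radon_norm \<Omega> T \<le> ereal C"
    unfolding radon_norm_def by (intro SUP_least) auto
  then show ?thesis by (auto simp: less_top[symmetric] top_ereal_def)
qed

subsection \<open>Density of polynomials in L2\<close>

text \<open>The pointwise inequality (a + b)^2 \<le> 2 a^2 + 2 b^2 stands in for the triangle
  inequality and avoids square roots of extended values.\<close>

lemma L2_norm_sq_add_le:
  assumes "set_borel_measurable lebesgue \<Omega> g" "set_borel_measurable lebesgue \<Omega> h"
    and f: "\<And>x. x \<in> \<Omega> \<Longrightarrow> f x = g x + h x"
  shows "L2_norm_sq \<Omega> f \<le> 2 * L2_norm_sq \<Omega> g + 2 * L2_norm_sq \<Omega> h"
proof -
  have eq: "ennreal ((k x)\<^sup>2) * indicator \<Omega> x = ennreal ((indicator \<Omega> x *\<^sub>R k x)\<^sup>2)" for k :: "'a \<Rightarrow> real" and x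
    by (simp add: indicator_def)
  have [measurable]: "(\<lambda>x. ennreal ((g x)\<^sup>2) * indicator \<Omega> x) \<in> borel_measurable lebesgue"
    "(\<lambda>x. ennreal ((h x)\<^sup>2) * indicator \<Omega> x) \<in> borel_measurable lebesgue"
    using assms(1,2) unfolding eq set_borel_measurable_def by measurable
  have "L2_norm_sq \<Omega> f \<le> (\<integral>\<^sup>+x. 2 * (ennreal ((g x)\<^sup>2) * indicator \<Omega> x) +
      2 * (ennreal ((h x)\<^sup>2) * indicator \<Omega> x) \<partial>lebesgue)"
    unfolding L2_norm_sq_def
  proof (intro nn_integral_mono)
    fix x
    show "ennreal ((f x)\<^sup>2) * indicator \<Omega> x
        \<le> 2 * (ennreal ((g x)\<^sup>2) * indicator \<Omega> x) + 2 * (ennreal ((h x)\<^sup>2) * indicator \<Omega> x)"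
    proof (cases "x \<in> \<Omega>")
      case True
      have "(g x + h x)\<^sup>2 \<le> 2 * (g x)\<^sup>2 + 2 * (h x)\<^sup>2"
        using zero_le_power2[of "g x - h x"] by (simp add: power2_eq_square algebra_simps)
      then have "ennreal ((f x)\<^sup>2) \<le> ennreal (2 * (g x)\<^sup>2 + 2 * (h x)\<^sup>2)"
        unfolding f[OF True] by (rule ennreal_leI)
      also have "\<dots> = 2 * ennreal ((g x)\<^sup>2) + 2 * ennreal ((h x)\<^sup>2)"
        by (simp add: ennreal_mult)
      finally show ?thesis using True by simp
    qed simp
  qed
  also have "\<dots> = 2 * L2_norm_sq \<Omega> g + 2 * L2_norm_sq \<Omega> h"
    unfolding L2_norm_sq_def by (subst nn_integral_add) (simp_all add: nn_integral_cmult)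
  finally show ?thesis .
qed

lemma set_borel_measurable_diff_real:
  fixes f g :: "'a \<Rightarrow> real"
  assumes "set_borel_measurable M A f" "set_borel_measurable M A g"
  shows "set_borel_measurable M A (\<lambda>x. f x - g x)"
  using assms unfolding set_borel_measurable_def scaleR_diff_right by measurable

text \<open>Dominated convergence: the error of truncation is at most \<open>f\<close> in absolute
  value, and at each point it is 0 as soon as \<open>n\<close> exceeds the value there.\<close>

lemma L2_norm_sq_truncate_tendsto_0:
  fixes f :: "'a::euclidean_space \<Rightarrow> real"
  assumes "f \<in> L2 \<Omega>"
  shows "(\<lambda>n. L2_norm_sq \<Omega> (\<lambda>x. f x - max (- real n) (min (real n) (f x)))) \<longlonglongrightarrow> 0"
proof -
  \<comment> \<open>Membership in \<open>L2\<close> gives measurability of the extension by zero.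
    Truncation fixes 0, so it commutes with this extension.\<close>
  let ?F = "\<lambda>x. indicator \<Omega> x *\<^sub>R f x"
  have [measurable]: "?F \<in> borel_measurable lebesgue"
    using assms by (simp add: L2_def set_borel_measurable_def)
  let ?u = "\<lambda>n x. ennreal ((?F x - max (- real n) (min (real n) (?F x)))\<^sup>2)"
  have "(\<lambda>n. \<integral>\<^sup>+x. ?u n x \<partial>lebesgue) \<longlonglongrightarrow> (\<integral>\<^sup>+x. 0 \<partial>(lebesgue :: 'a measure))"
  proof (rule nn_integral_dominated_convergence[where w="\<lambda>x. ennreal ((?F x)\<^sup>2)"])
    have "(\<integral>\<^sup>+x. ennreal ((?F x)\<^sup>2) \<partial>lebesgue) = L2_norm_sq \<Omega> f"
      unfolding L2_norm_sq_def by (intro nn_integral_cong) (simp add: indicator_def)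
    then show "(\<integral>\<^sup>+x. ennreal ((?F x)\<^sup>2) \<partial>lebesgue) < \<infinity>"
      using assms by (simp add: L2_def)
    have "(a - max (- real n) (min (real n) a))\<^sup>2 \<le> a\<^sup>2" for a n
      by (subst abs_le_square_iff[symmetric]) auto
    then show "AE x in lebesgue. ?u n x \<le> ennreal ((?F x)\<^sup>2)" for n
      by (intro AE_I2 ennreal_leI) blast
    have "(\<lambda>n. ?u n x) \<longlonglongrightarrow> 0" for x
    proof (rule tendsto_eventually)
      obtain N where N: "\<bar>?F x\<bar> \<le> real N" using real_arch_simple by blast
      show "\<forall>\<^sub>F n in sequentially. ?u n x = 0"
      proof (rule eventually_sequentiallyI[of N])
        fix n assume "N \<le> n"
        then have "max (- real n) (min (real n) (?F x)) = ?F x"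
          using N by linarith
        then show "?u n x = 0" by simp
      qed
    qed
    then show "AE x in lebesgue. (\<lambda>n. ?u n x) \<longlonglongrightarrow> 0" by simp
  qed measurable
  moreover have "(\<integral>\<^sup>+x. ?u n x \<partial>lebesgue) = L2_norm_sq \<Omega> (\<lambda>x. f x - max (- real n) (min (real n) (f x)))" for n
    unfolding L2_norm_sq_def by (intro nn_integral_cong) (simp add: indicator_def)
  ultimately show ?thesis by simp
qed

text \<open>A Lebesgue measurable function is an almost everywhere limit of continuous functions.
  Clipping these at level \<open>m\<close> too bounds the squared differences by
  \<open>(2 * m)\<^sup>2\<close>, which is integrable over the bounded \<Omega>, so dominated
  convergence applies.\<close>

lemma continuous_approximation_of_truncation:
  fixes f :: "'a::euclidean_space \<Rightarrow> real"
  assumes "f \<in> L2 \<Omega>" "open \<Omega>" "bounded \<Omega>" "e > 0" "m \<ge> 0"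
  obtains g where "continuous_on UNIV g"
    "L2_norm_sq \<Omega> (\<lambda>x. max (- m) (min m (f x)) - g x) < e"
proof -
  let ?c = "\<lambda>a. max (- m) (min m a)"
  let ?F = "\<lambda>x. indicator \<Omega> x *\<^sub>R f x"
  have F[measurable]: "?F \<in> borel_measurable lebesgue"
    using assms by (simp add: L2_def set_borel_measurable_def)
  then have "?F measurable_on UNIV"
    by (simp add: measurable_on_iff_borel_measurable lebesgue_on_UNIV_eq)
  \<comment> \<open>Unfolding \<open>measurable_on\<close> supplies the continuous approximants and
    the exceptional null set.\<close>
  then obtain N g where N: "negligible N" and g: "\<And>n::nat. continuous_on UNIV (g n)"
    and lim: "\<And>x. x \<notin> N \<Longrightarrow> (\<lambda>n. g n x) \<longlonglongrightarrow> ?F x"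
    unfolding measurable_on_def by auto
  have [measurable]: "g n \<in> borel_measurable lebesgue" for n
    using borel_measurable_continuous_onI[OF g] by (simp add: measurable_completion)
  have [measurable]: "\<Omega> \<in> sets lebesgue" using assms by simp
  let ?u = "\<lambda>n x. ennreal ((?c (?F x) - ?c (g n x))\<^sup>2) * indicator \<Omega> x"
  have "(\<lambda>n. \<integral>\<^sup>+x. ?u n x \<partial>lebesgue) \<longlonglongrightarrow> (\<integral>\<^sup>+x. 0 \<partial>(lebesgue :: 'a measure))"
  proof (rule nn_integral_dominated_convergence[where w="\<lambda>x. ennreal ((2 * m)\<^sup>2) * indicator \<Omega> x"])
    show "(\<integral>\<^sup>+x. ennreal ((2 * m)\<^sup>2) * indicator \<Omega> x \<partial>lebesgue) < \<infinity>"
      using emeasure_bounded_finite[OF assms(3)] assms(2)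
      by (simp add: nn_integral_cmult_indicator ennreal_mult_less_top)
    have "(?c a - ?c b)\<^sup>2 \<le> (2 * m)\<^sup>2" for a b
      using assms(5) by (subst abs_le_square_iff[symmetric]) auto
    then show "AE x in lebesgue. ?u n x \<le> ennreal ((2 * m)\<^sup>2) * indicator \<Omega> x" for n
      by (intro AE_I2 mult_right_mono ennreal_leI) auto
    have "(\<lambda>n. ?u n x) \<longlonglongrightarrow> 0" if "x \<notin> N" for x
    proof -
      have "(\<lambda>n. ennreal ((?c (?F x) - ?c (g n x))\<^sup>2)) \<longlonglongrightarrow> ennreal ((?c (?F x) - ?c (?F x))\<^sup>2)"
        by (intro tendsto_intros lim that)
      then show ?thesis by (cases "x \<in> \<Omega>") simp_all
    qed
    then show "AE x in lebesgue. (\<lambda>n. ?u n x) \<longlonglongrightarrow> 0"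
      using N by (intro AE_I'[of N]) (auto simp: negligible_iff_null_sets)
  qed measurable
  then have "\<forall>\<^sub>F n in sequentially. (\<integral>\<^sup>+x. ?u n x \<partial>lebesgue) < e"
    using assms(4) by (auto intro: order_tendstoD)
  then obtain n where n: "(\<integral>\<^sup>+x. ?u n x \<partial>lebesgue) < e"
    by (meson eventually_sequentially order_refl)
  have "L2_norm_sq \<Omega> (\<lambda>x. ?c (f x) - ?c (g n x)) = (\<integral>\<^sup>+x. ?u n x \<partial>lebesgue)"
    unfolding L2_norm_sq_def by (intro nn_integral_cong) (simp add: indicator_def)
  moreover have "continuous_on UNIV (\<lambda>x. ?c (g n x))"
    by (intro continuous_intros g)
  ultimately show thesis using that n by metis
qed

text \<open>Stone-Weierstrass on the compact closure of \<Omega> gives a uniform error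
  \<open>d\<close>, and the squared L2 error is then at most \<open>d\<^sup>2\<close> times the
  volume of \<Omega>.\<close>

lemma polynomial_approximation_of_continuous:
  fixes g :: "'a::euclidean_space \<Rightarrow> real"
  assumes "continuous_on UNIV g" "open \<Omega>" "bounded \<Omega>" "(e::real) > 0"
  obtains p where "real_polynomial_function p" "L2_norm_sq \<Omega> (\<lambda>x. g x - p x) < e"
proof -
  \<comment> \<open>The summand 1 covers volume 0 and makes the final estimate strict.\<close>
  define d where "d = sqrt (e / (1 + measure lborel \<Omega>))"
  have m: "1 + measure lborel \<Omega> > 0" by (simp add: add_pos_nonneg)
  have d: "d > 0" "d\<^sup>2 = e / (1 + measure lborel \<Omega>)"
    using assms(4) m by (auto simp: d_def)
  obtain p where p: "real_polynomial_function p" "\<And>x. x \<in> closure \<Omega> \<Longrightarrow> \<bar>g x - p x\<bar> < d"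
    using Stone_Weierstrass_real_polynomial_function[OF _ continuous_on_subset[OF assms(1)] d(1), of "closure \<Omega>"]
      assms(3) by (metis compact_closure top_greatest)
  have "L2_norm_sq \<Omega> (\<lambda>x. g x - p x) \<le> (\<integral>\<^sup>+x. ennreal (d\<^sup>2) * indicator \<Omega> x \<partial>lebesgue)"
    unfolding L2_norm_sq_def
  proof (intro nn_integral_mono)
    fix x
    have "(g x - p x)\<^sup>2 \<le> d\<^sup>2" if "x \<in> \<Omega>"
      using p(2)[of x] closure_subset[of \<Omega>] that d(1) by (subst abs_le_square_iff[symmetric]) auto
    then show "ennreal ((g x - p x)\<^sup>2) * indicator \<Omega> x \<le> ennreal (d\<^sup>2) * indicator \<Omega> x"
      by (auto simp: indicator_def intro: ennreal_leI)
  qed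
  also have "\<dots> = ennreal (d\<^sup>2) * emeasure lborel \<Omega>"
    using assms(2) by (simp add: nn_integral_cmult_indicator)
  also have "\<dots> = ennreal (d\<^sup>2 * measure lborel \<Omega>)"
    using emeasure_bounded_finite[OF assms(3)]
    by (simp add: ennreal_mult emeasure_eq_ennreal_measure)
  also have "\<dots> < ennreal e"
  proof (rule ennreal_lessI)
    show "d\<^sup>2 * measure lborel \<Omega> < e"
      unfolding d(2) using assms(4) m by (simp add: field_simps)
  qed fact
  finally show thesis using that p(1) by metis
qed

text \<open>Three approximations in a row: truncate \<open>f\<close>, replace the truncation by a
  continuous function, and that by a polynomial.\<close>

lemma polynomial_approximation_L2:
  fixes f :: "'a::euclidean_space \<Rightarrow> real"
  assumes "f \<in> L2 \<Omega>" "open \<Omega>" "bounded \<Omega>" "(e::real) > 0"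
  obtains p where "real_polynomial_function p" "L2_norm_sq \<Omega> (\<lambda>x. f x - p x) < e"
proof -
  \<comment> \<open>Two uses of \<open>L2_norm_sq_add_le\<close> weight the three errors by 2, 4 and
    4, so errors below \<open>e / 16\<close> add up to at most \<open>10 * e / 16\<close>.\<close>
  have e: "ennreal (e / 16) > 0" using assms(4) by simp
  let ?c = "\<lambda>n x. max (- real n) (min (real n) (f x))"
  have "\<forall>\<^sub>F n in sequentially. L2_norm_sq \<Omega> (\<lambda>x. f x - ?c n x) < e / 16"
    by (rule order_tendstoD(2)[OF L2_norm_sq_truncate_tendsto_0[OF assms(1)] e])
  then obtain n where n: "L2_norm_sq \<Omega> (\<lambda>x. f x - ?c n x) < e / 16"
    by (meson eventually_sequentially order_refl)
  obtain g where g: "continuous_on UNIV g" "L2_norm_sq \<Omega> (\<lambda>x. ?c n x - g x) < e / 16"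
    using continuous_approximation_of_truncation[OF assms(1-3) e, of "real n"] by auto
  obtain p where p: "real_polynomial_function p" "L2_norm_sq \<Omega> (\<lambda>x. g x - p x) < e / 16"
    using polynomial_approximation_of_continuous[OF g(1) assms(2,3), of "e / 16"] assms(4) by auto
  have fm: "set_borel_measurable lebesgue \<Omega> f" using assms(1) by (simp add: L2_def)
  have cm: "set_borel_measurable lebesgue \<Omega> (?c n)"
  proof -
    have [measurable]: "(\<lambda>x. indicator \<Omega> x *\<^sub>R f x) \<in> borel_measurable lebesgue"
      using fm by (simp add: set_borel_measurable_def)
    have "(\<lambda>x. max (- real n) (min (real n) (indicator \<Omega> x *\<^sub>R f x))) \<in> borel_measurable lebesgue"
      by measurable
    then show ?thesis
      unfolding set_borel_measurable_def
      by (rule back_subst[of "\<lambda>h. h \<in> borel_measurable lebesgue"]) (auto simp: indicator_def)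
  qed
  have cont: "set_borel_measurable lebesgue \<Omega> h" if "continuous_on UNIV h" for h :: "'a \<Rightarrow> real"
    unfolding set_borel_measurable_def using assms(2) borel_measurable_continuous_onI[OF that]
    by (intro borel_measurable_scaleR measurable_completion borel_measurable_indicator) auto
  have gm: "set_borel_measurable lebesgue \<Omega> g" and pm: "set_borel_measurable lebesgue \<Omega> p"
    using g(1) p(1) continuous_on_polymonial_function[of p] by (auto intro!: cont simp: real_polynomial_function_eq)
  have gp: "L2_norm_sq \<Omega> (\<lambda>x. ?c n x - p x) \<le> 2 * L2_norm_sq \<Omega> (\<lambda>x. ?c n x - g x) + 2 * L2_norm_sq \<Omega> (\<lambda>x. g x - p x)"
    by (intro L2_norm_sq_add_le set_borel_measurable_diff_real cm gm pm) simp
  have fp: "L2_norm_sq \<Omega> (\<lambda>x. f x - p x) \<le> 2 * L2_norm_sq \<Omega> (\<lambda>x. f x - ?c n x) + 2 * L2_norm_sq \<Omega> (\<lambda>x. ?c n x - p x)"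
    by (intro L2_norm_sq_add_le set_borel_measurable_diff_real fm cm pm) simp
  have two: "2 * ennreal a = ennreal (2 * a)" if "a \<ge> 0" for a
    using that by (simp add: ennreal_mult)
  have "L2_norm_sq \<Omega> (\<lambda>x. f x - p x) \<le>
      2 * ennreal (e / 16) + 2 * (2 * ennreal (e / 16) + 2 * ennreal (e / 16))"
    using n g(2) p(2) by (intro order_trans[OF fp] add_mono mult_left_mono order_trans[OF gp]) auto
  also have "\<dots> = ennreal (e * 10 / 16)"
    using assms(4) by (simp add: two flip: ennreal_plus)
  also have "\<dots> < ennreal e"
    using assms(4) by (intro ennreal_lessI) auto
  finally show thesis using that p(1) by metis
qed

subsection \<open>Competitors for the objective\<close>

text \<open>The zero test function is admissible in the supremum. This also excludes the value minus
  infinity when a finite norm is turned into a real number.\<close>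

lemma radon_norm_nonneg:
  assumes "T (\<lambda>_. 0) = 0"
  shows "0 \<le> radon_norm \<Omega> T"
  unfolding radon_norm_def
  by (rule SUP_upper2[of "\<lambda>_. 0"]) (use assms zero_in_test_functions in auto)

lemma radon_norm_eq_0:
  assumes "\<And>v. v \<in> test_functions \<Omega> \<Longrightarrow> T v = 0"
  shows "radon_norm \<Omega> T = 0"
proof (rule antisym)
  show "radon_norm \<Omega> T \<le> 0"
    unfolding radon_norm_def by (rule SUP_least) (use assms in auto)
qed (use assms zero_in_test_functions radon_norm_nonneg in blast)

lemma partial_deriv_const: "partial_deriv j (\<lambda>_. c) x = 0"
  by (simp add: partial_deriv_def)

lemma dist_grad_zero: "dist_grad \<Omega> u (\<lambda>_. 0) = 0"
  by (simp add: dist_grad_def partial_deriv_const)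

lemma dist_sym_grad_zero: "dist_sym_grad \<Omega> w (\<lambda>_. 0) = 0"
proof -
  have "transpose (0 :: real^'a^'a) = 0" by (vector transpose_def)
  then show ?thesis by (simp add: dist_sym_grad_def dist_jacobian_def partial_deriv_const)
qed

lemma dist_of_fun_zero: "dist_of_fun \<Omega> w (\<lambda>_. 0) = 0"
  by (simp add: dist_of_fun_def)

lemma set_integrable_continuous_bounded:
  fixes g :: "'a::euclidean_space \<Rightarrow> 'b::euclidean_space"
  assumes "open \<Omega>" "bounded \<Omega>" "continuous_on UNIV g"
  shows "set_integrable lebesgue \<Omega> g"
proof -
  have "integrable lborel (\<lambda>x. indicator (closure \<Omega>) x *\<^sub>R g x)"
    using assms by (intro borel_integrable_compact continuous_on_subset[OF assms(3)]) (auto simp: compact_closure)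
  then have "set_integrable lborel (closure \<Omega>) g"
    by (simp add: set_integrable_def)
  then have "set_integrable lborel \<Omega> g"
    by (rule set_integrable_subset) (use assms(1) closure_subset in auto)
  then show ?thesis
    unfolding set_integrable_def by (subst integrable_completion) (auto intro: borel_measurable_integrable)
qed

lemma
  fixes p :: "real^'d \<Rightarrow> real"
  assumes p: "real_polynomial_function p"
  shows partial_deriv_polynomial: "real_polynomial_function (partial_deriv j p)"
    and continuous_on_partial_deriv_polynomial: "continuous_on UNIV (partial_deriv j p)"
proof -
  show "real_polynomial_function (partial_deriv j p)"
    using real_polynomial_function_frechet_derivative[OF p] by (simp add: partial_deriv_def[abs_def])
  then show "continuous_on UNIV (partial_deriv j p)"
    by (intro continuous_on_polymonial_function) (simp add: real_polynomial_function_eq)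
qed

text \<open>A polynomial and its gradient are bounded on the bounded \<Omega>, so the gradient is
  the density of a finite measure.\<close>

lemma real_polynomial_function_in_BV:
  assumes \<Omega>: "open \<Omega>" "bounded \<Omega>" and p: "real_polynomial_function p"
  shows "p \<in> BV \<Omega>"
proof -
  have "continuous_on UNIV (\<lambda>x. \<chi> j. partial_deriv j p x)"
    by (intro continuous_intros continuous_on_partial_deriv_polynomial[OF p])
  then have "finite_radon_measure_on \<Omega> (dist_grad \<Omega> p)"
    using dist_grad_eq_dist_of_fun[OF real_polynomial_function_differentiable[OF p]
        continuous_on_partial_deriv_polynomial[OF p]]
    by (rule finite_radon_measure_on_dist_of_fun[OF \<Omega>])
  moreover have "continuous_on UNIV p"
    using p by (simp add: continuous_on_polymonial_function real_polynomial_function_eq)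
  ultimately show ?thesis
    by (simp add: BV_def set_integrable_continuous_bounded[OF \<Omega>])
qed

lemma polynomial_vector_field_in_BD:
  assumes \<Omega>: "open \<Omega>" "bounded \<Omega>" and w: "\<And>i. real_polynomial_function (\<lambda>x. w x $ i)"
  shows "w \<in> BD \<Omega>"
proof -
  let ?J = "\<lambda>x. \<chi> i j. partial_deriv j (\<lambda>y. w y $ i) x"
  have "continuous_on UNIV (\<lambda>x. (1/2) *\<^sub>R (?J x + transpose (?J x)))"
    by (intro continuous_intros continuous_on_partial_deriv_polynomial w
        bounded_linear.continuous_on[OF bounded_linear_transpose])
  then have "finite_radon_measure_on \<Omega> (dist_sym_grad \<Omega> w)"
    using dist_sym_grad_eq_dist_of_fun[OF real_polynomial_function_differentiable[OF w]
        continuous_on_partial_deriv_polynomial[OF w]]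
    by (rule finite_radon_measure_on_dist_of_fun[OF \<Omega>])
  moreover have "continuous_on UNIV w"
  proof -
    have "continuous_on UNIV (\<lambda>x. \<chi> i. w x $ i)"
      using w[unfolded real_polynomial_function_eq]
      by (intro continuous_on_vec_lambda continuous_on_polymonial_function)
    then show ?thesis by simp
  qed
  ultimately show ?thesis
    by (simp add: BD_def set_integrable_continuous_bounded[OF \<Omega>])
qed

lemma L2_norm_sq_le_TGV_objective:
  assumes "\<alpha> \<ge> 0" "\<beta> \<ge> 0"
  shows "ereal (1/2) * enn2ereal (L2_norm_sq \<Omega> (\<lambda>x. f x - u x)) \<le> TGV_objective \<Omega> f \<alpha> \<beta> u w"
proof -
  have "0 \<le> radon_norm \<Omega> (\<lambda>v. dist_grad \<Omega> u v - dist_of_fun \<Omega> w v)"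
    by (rule radon_norm_nonneg) (simp add: dist_grad_zero dist_of_fun_zero)
  then have "0 \<le> ereal \<alpha> * radon_norm \<Omega> (\<lambda>v. dist_grad \<Omega> u v - dist_of_fun \<Omega> w v)"
    using assms(1) by (intro ereal_0_le_mult) simp_all
  moreover have "0 \<le> ereal \<beta> * radon_norm \<Omega> (dist_sym_grad \<Omega> w)"
    using assms(2) radon_norm_nonneg[of "dist_sym_grad \<Omega> w" \<Omega>, OF dist_sym_grad_zero]
    by (intro ereal_0_le_mult) simp_all
  ultimately have "X + 0 + 0 \<le> X + ereal \<alpha> * radon_norm \<Omega> (\<lambda>v. dist_grad \<Omega> u v - dist_of_fun \<Omega> w v)
      + ereal \<beta> * radon_norm \<Omega> (dist_sym_grad \<Omega> w)" for X
    by (intro add_mono order_refl)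
  then show ?thesis
    unfolding TGV_objective_def by simp
qed

lemma ennreal_le_of_half_enn2ereal_le:
  assumes "ereal (1/2) * enn2ereal A \<le> ereal (c / 2)"
  shows "A \<le> ennreal c"
proof (cases A)
  case (real a)
  then show ?thesis using assms by (simp add: enn2ereal_ennreal ennreal_leI)
next
  case top
  then show ?thesis using assms by simp
qed

text \<open>The slope \<open>K\<close> may depend on \<open>e\<close>: first \<open>e\<close> is
  fixed below the target, then \<open>t\<close> is made small enough for \<open>t * K\<close> to be
  absorbed. This matches a competitor that is chosen according to the accuracy
  \<open>e\<close>.\<close>

lemma tendsto_0_at_right_ennrealI:
  fixes A :: "real \<Rightarrow> ennreal"
  assumes "\<And>e::real. e > 0 \<Longrightarrow> \<exists>K. \<forall>t>0. A t \<le> ennreal (e + t * K)"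
  shows "(A \<longlongrightarrow> 0) (at_right 0)"
proof (rule order_tendstoI)
  fix a :: ennreal assume "0 < a"
  \<comment> \<open>If \<open>a\<close> is infinite, \<open>e = 1\<close> serves.\<close>
  then obtain e :: real where e: "e > 0" "ennreal e \<le> a"
    by (cases a) (auto intro: that that[of 1] simp: zero_less_iff_neq_zero less_le)
  obtain K where K: "\<And>t. t > 0 \<Longrightarrow> A t \<le> ennreal (e / 2 + t * K)"
    using assms[of "e / 2"] e by auto
  have "((\<lambda>t. e / 2 + t * K) \<longlongrightarrow> e / 2 + 0 * K) (at_right 0)"
    by (intro tendsto_intros)
  then have "\<forall>\<^sub>F t in at_right 0. e / 2 + t * K < e"
    by (rule order_tendstoD(2)) (use e in simp)
  moreover have "\<forall>\<^sub>F t in at_right (0::real). t > 0"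
    by (rule eventually_at_right_less)
  ultimately show "\<forall>\<^sub>F t in at_right 0. A t < a"
  proof eventually_elim
    case (elim t)
    have "A t \<le> ennreal (e / 2 + t * K)" using K elim by blast
    also have "\<dots> < ennreal e" using elim e by (intro ennreal_lessI) auto
    finally show ?case using e(2) by simp
  qed
qed simp

section \<open>Convergence of the fidelity term in either parameter\<close>

theorem proposition1:
  fixes \<Omega> :: "(real^'d) set"
    and f :: "real^'d \<Rightarrow> real"
    and u :: "real \<Rightarrow> real \<Rightarrow> real^'d \<Rightarrow> real"
    and w :: "real \<Rightarrow> real \<Rightarrow> real^'d \<Rightarrow> real^'d"
  assumes "open \<Omega>" and "bounded \<Omega>"
    and "f \<in> L2 \<Omega> \<inter> BV \<Omega>"
    and "\<And>\<alpha> \<beta>. \<alpha> > 0 \<Longrightarrow> \<beta> > 0 \<Longrightarrow>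
           is_arg_min (\<lambda>(u', w'). TGV_objective \<Omega> f \<alpha> \<beta> u' w')
             (\<lambda>(u', w'). u' \<in> BV \<Omega> \<and> w' \<in> BD \<Omega>) (u \<beta> \<alpha>, w \<beta> \<alpha>)"
  shows "(\<forall>\<alpha>>0. ((\<lambda>\<beta>. L2_norm_sq \<Omega> (\<lambda>x. f x - u \<beta> \<alpha> x)) \<longlongrightarrow> 0) (at_right 0))
       \<and> (\<forall>\<beta>>0. ((\<lambda>\<alpha>. L2_norm_sq \<Omega> (\<lambda>x. f x - u \<beta> \<alpha> x)) \<longlongrightarrow> 0) (at_right 0))"
proof -
  \<comment> \<open>Any admissible pair bounds the minimal value. The bound is written as
    \<open>c / 2\<close> to cancel the factor 1/2 of the fidelity term.\<close>
  have competitor: "L2_norm_sq \<Omega> (\<lambda>x. f x - u \<beta> \<alpha> x) \<le> ennreal c"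
    if "\<alpha> > 0" "\<beta> > 0" "u' \<in> BV \<Omega>" "w' \<in> BD \<Omega>" "TGV_objective \<Omega> f \<alpha> \<beta> u' w' \<le> ereal (c / 2)"
    for \<alpha> \<beta> u' w' c
  proof (rule ennreal_le_of_half_enn2ereal_le)
    have "ereal (1/2) * enn2ereal (L2_norm_sq \<Omega> (\<lambda>x. f x - u \<beta> \<alpha> x))
        \<le> TGV_objective \<Omega> f \<alpha> \<beta> (u \<beta> \<alpha>) (w \<beta> \<alpha>)"
      using that by (intro L2_norm_sq_le_TGV_objective) auto
    also have "\<dots> \<le> TGV_objective \<Omega> f \<alpha> \<beta> u' w'"
      using assms(4)[OF that(1,2)] that(3,4) by (auto simp: is_arg_min_def not_less)
    finally show "ereal (1/2) * enn2ereal (L2_norm_sq \<Omega> (\<lambda>x. f x - u \<beta> \<alpha> x)) \<le> ereal (c / 2)"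
      using that(5) by (rule order_trans)
  qed
  have "((\<lambda>\<beta>. L2_norm_sq \<Omega> (\<lambda>x. f x - u \<beta> \<alpha> x)) \<longlongrightarrow> 0) (at_right 0)" if "\<alpha> > 0" for \<alpha>
  proof (rule tendsto_0_at_right_ennrealI)
    fix e :: real assume "e > 0"
    then obtain p where p: "real_polynomial_function p" "L2_norm_sq \<Omega> (\<lambda>x. f x - p x) < e"
      using polynomial_approximation_L2[of f \<Omega> e] assms by auto
    \<comment> \<open>\<open>W\<close> is the classical gradient of \<open>p\<close>, so it
      represents \<open>Dp\<close> on every test function and the middle term is 0.\<close>
    define W where "W x = (\<chi> j. partial_deriv j p x)" for x
    have BV: "p \<in> BV \<Omega>" using real_polynomial_function_in_BV assms p by blast
    have BD: "W \<in> BD \<Omega>"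
      by (rule polynomial_vector_field_in_BD[OF assms(1,2)])
        (simp add: W_def partial_deriv_polynomial[OF p(1)])
    have grad: "radon_norm \<Omega> (\<lambda>v. dist_grad \<Omega> p v - dist_of_fun \<Omega> W v) = 0"
      using dist_grad_eq_dist_of_fun[OF real_polynomial_function_differentiable[OF p(1)]
          continuous_on_partial_deriv_polynomial[OF p(1)]]
      by (intro radon_norm_eq_0) (simp add: W_def[abs_def])
    have "radon_norm \<Omega> (dist_sym_grad \<Omega> W) < \<infinity>"
      using BD radon_norm_finite by (auto simp: BD_def)
    \<comment> \<open>\<open>K\<close> depends on \<open>p\<close>, hence on \<open>e\<close>, but
      not on \<beta>.\<close>
    then obtain K where K: "radon_norm \<Omega> (dist_sym_grad \<Omega> W) = ereal K"
      using radon_norm_nonneg[of "dist_sym_grad \<Omega> W" \<Omega>, OF dist_sym_grad_zero]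
      by (cases "radon_norm \<Omega> (dist_sym_grad \<Omega> W)") auto
    have "enn2ereal (L2_norm_sq \<Omega> (\<lambda>x. f x - p x)) \<le> ereal e"
      using p(2) \<open>e > 0\<close> by (metis enn2ereal_ennreal less_eq_ennreal.rep_eq less_imp_le)
    then have "ereal (1/2) * enn2ereal (L2_norm_sq \<Omega> (\<lambda>x. f x - p x)) \<le> ereal (1/2) * ereal e"
      by (rule ereal_mult_left_mono) simp
    \<comment> \<open>The objective is at most \<open>e / 2 + \<beta> * K\<close>, put into the form
      that \<open>competitor\<close> expects; this doubles the slope.\<close>
    then have "TGV_objective \<Omega> f \<alpha> \<beta> p W \<le> ereal ((e + \<beta> * (2 * K)) / 2)" for \<beta>
      using add_mono[OF _ order_refl[of "ereal (\<beta> * K)"]]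
      by (force simp: TGV_objective_def grad K add_divide_distrib)
    from competitor[OF that _ BV BD this]
    show "\<exists>K. \<forall>\<beta>>0. L2_norm_sq \<Omega> (\<lambda>x. f x - u \<beta> \<alpha> x) \<le> ennreal (e + \<beta> * K)"
      by blast
  qed
  moreover have "((\<lambda>\<alpha>. L2_norm_sq \<Omega> (\<lambda>x. f x - u \<beta> \<alpha> x)) \<longlongrightarrow> 0) (at_right 0)" if "\<beta> > 0" for \<beta>
  proof (rule tendsto_0_at_right_ennrealI)
    fix e :: real assume "e > 0"
    have BV: "f \<in> BV \<Omega>" using assms(3) by simp
    have BD: "(\<lambda>_. 0) \<in> BD \<Omega>"
      by (rule polynomial_vector_field_in_BD[OF assms(1,2)]) auto
    have sym: "radon_norm \<Omega> (dist_sym_grad \<Omega> (\<lambda>_. 0)) = 0"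
      by (rule radon_norm_eq_0) (simp add: dist_sym_grad_def dist_jacobian_def)
    have "radon_norm \<Omega> (dist_grad \<Omega> f) < \<infinity>"
      using BV radon_norm_finite by (auto simp: BV_def)
    then obtain K where K: "radon_norm \<Omega> (dist_grad \<Omega> f) = ereal K"
      using radon_norm_nonneg[of "dist_grad \<Omega> f" \<Omega>, OF dist_grad_zero]
      by (cases "radon_norm \<Omega> (dist_grad \<Omega> f)") auto
    \<comment> \<open>At \<open>(f, 0)\<close> the first and last terms vanish, which leaves
      \<alpha> times the Radon norm of \<open>Df\<close>.\<close>
    have "TGV_objective \<Omega> f \<alpha> \<beta> f (\<lambda>_. 0) = ereal (2 * (\<alpha> * K) / 2)" for \<alpha>
      by (simp add: TGV_objective_def L2_norm_sq_def dist_of_fun_def sym K zero_ennreal.rep_eq)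
    from competitor[OF _ that BV BD eq_refl[OF this]]
    have "L2_norm_sq \<Omega> (\<lambda>x. f x - u \<beta> \<alpha> x) \<le> ennreal (2 * (\<alpha> * K))" if "\<alpha> > 0" for \<alpha>
      using that .
    \<comment> \<open>The positive \<open>e\<close> is added to reach the form of the convergence
      criterion.\<close>
    moreover have "ennreal (2 * (\<alpha> * K)) \<le> ennreal (e + \<alpha> * (2 * K))" for \<alpha>
      using \<open>e > 0\<close> by (intro ennreal_leI) simp
    ultimately show "\<exists>K. \<forall>\<alpha>>0. L2_norm_sq \<Omega> (\<lambda>x. f x - u \<beta> \<alpha> x) \<le> ennreal (e + \<alpha> * K)"
      by (intro exI[of _ "2 * K"]) (meson order_trans)
  qed
  ultimately show ?thesis by blast
qed

end
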